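(* Let $0<\gamma<1$, $\lambda>0$, $\kappa\in[0,1)$, and let $X\sim\mathrm{SDS}(\gamma,\lambda,\kappa)$. Then $$\lim_{x\to\infty}x^{2\gamma}\,\mathbb{P}(|X|>x)=\begin{cases}\dfrac{\lambda}{2^{\gamma}}\dfrac{(1+\kappa)^{\gamma}}{(1-\kappa)^{2\gamma}}\dfrac{1}{\Gamma(1-2\gamma)\cos(\pi\gamma)}, & \text{if }\gamma\ne\frac12,\\[3mm] \dfrac{\lambda}{2^{\gamma}}\dfrac{(1+\kappa)^{\gamma}}{(1-\kappa)^{2\gamma}}\dfrac{2}{\pi}, & \text{if }\gamma=\frac12.\end{cases}$$
   Context: For $\gamma\in(0,1]$, $\lambda>0$, $\kappa\in[0,1)$, $\mathrm{SDS}(\gamma,\lambda,\kappa)$ denotes the symmetric distribution on $\mathbb{Z}$ with characteristic function $$f(t)=\exp\left\{-\lambda\left(\frac{(1-\cos t)(1+\kappa)}{\kappa^2-2\kappa\cos t+1}\right)^{\gamma}\right\}.$$ $\Gamma$ is the Gamma function. *)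

theory Defs
  imports "HOL-Probability.Probability"
begin

definition sds_cf :: "real \<Rightarrow> real \<Rightarrow> real \<Rightarrow> real \<Rightarrow> real" where
  "sds_cf \<gamma> lam \<kappa> t =
     exp (- lam * (((1 - cos t) * (1 + \<kappa>)) / (\<kappa>\<^sup>2 - 2 * \<kappa> * cos t + 1)) powr \<gamma>)"

text \<open>The parameter ranges are left to the theorems that use the predicate. The library's
  \<^const>\<open>char\<close> is for measures on the reals, so a law on the integers is first pushed
  forward along the embedding.\<close>

definition is_SDS :: "real \<Rightarrow> real \<Rightarrow> real \<Rightarrow> int measure \<Rightarrow> bool" where
  "is_SDS \<gamma> lam \<kappa> D \<longleftrightarrow>
     prob_space D \<and> sets D = sets (count_space UNIV) \<and>
     distr D (count_space UNIV) uminus = D \<and>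
     (\<forall>t. char (distr D borel real_of_int) t = complex_of_real (sds_cf \<gamma> lam \<kappa> t))"

end

theory Submission
  imports Defs "HOL-Real_Asymp.Real_Asymp"
begin

text \<open>
  The tail is determined by two features of the law: it is symmetric, and its characteristic
  function \<open>\<phi>\<close> satisfies \<open>1 - \<phi>(t) \<sim> a \<bar>t\<bar>\<^sup>\<alpha>\<close> at \<open>0\<close>, where \<open>\<alpha> = 2\<gamma> \<in> (0, 2)\<close> and \<open>a\<close> is the
  common factor of the two limits in the theorem. For every such law a Tauberian theorem of
  Pitman gives \<open>P(\<bar>Y\<bar> > x) \<sim> (2/\<pi>) a \<Gamma>(\<alpha>) sin(\<pi>\<alpha>/2) / x\<^sup>\<alpha>\<close>
  (\<open>tail_asymptotics_of_char\<close>), and the reflection formula for \<open>\<Gamma>\<close> rewrites this constant.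

  The Tauberian theorem comes from a continuity theorem for Levy measures. Rescale: as
  \<open>b \<rightarrow> \<infinity>\<close>, the measures \<open>\<nu>\<^sub>b = b\<^sup>\<alpha> \<cdot> law(Y/b)\<close> have exponents
  \<open>\<integral> (1 - cos(tx)) d\<nu>\<^sub>b = b\<^sup>\<alpha> (1 - \<phi>(t/b)) \<rightarrow> a \<bar>t\<bar>\<^sup>\<alpha>\<close>, which is the exponent of a measure \<open>\<nu>\<close>
  with density a multiple of \<open>\<bar>x\<bar> powr (-1-\<alpha>)\<close>. If this convergence of
  exponents forces \<open>\<nu>\<^sub>b{\<bar>x\<bar> > 1} \<rightarrow> \<nu>{\<bar>x\<bar> > 1}\<close>, we are done, because the left-hand side is
  \<open>b\<^sup>\<alpha> P(\<bar>Y\<bar> > b)\<close>.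

  The total mass of \<open>\<nu>\<^sub>b\<close> is \<open>b\<^sup>\<alpha>\<close>, with the excess piling up at the origin, so the continuity
  theorem for characteristic functions does not apply to \<open>\<nu>\<^sub>b\<close> itself. It applies to the
  normalised measures \<open>h d\<nu>\<^sub>b\<close> with \<open>h(x) = 1 - exp(-x\<^sup>2/2)\<close>. This weight is the average of \<open>1 - cos(Zx)\<close> over a
  standard normal \<open>Z\<close>. Hence, by Fubini and the product formula for cosines, the Fourier transform
  of \<open>h d\<nu>\<close> is an average of values of the exponent of \<open>\<nu>\<close>
  (\<open>integral_tilt_weight_cos\<close>), and pointwise convergence of exponents yields convergence of
  characteristic functions. Away from the origin \<open>h\<close> is bounded below, so the tail of \<open>\<nu>\<close> is the
  integral of the bounded function \<open>1{\<bar>x\<bar> > 1} / h\<close> against \<open>h d\<nu>\<close>, and weak convergence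
  transfers it to the limit (\<open>levy_tail_continuity\<close>).

  The constant comes from the integral of \<open>(1 - cos x) * x powr (-1-\<alpha>)\<close> over the positive
  half-line. Writing the power as a Laplace transform turns it into a Beta integral, in a way that
  treats \<open>\<alpha> < 1\<close>, \<open>\<alpha> = 1\<close> and \<open>\<alpha> > 1\<close> alike (\<open>nn_integral_one_minus_cos_powr\<close>); the
  case distinction in the theorem is due only to the zero of \<open>cos(\<pi>\<gamma>)\<close> and the pole of
  \<open>\<Gamma>(1 - 2\<gamma>)\<close> at \<open>\<gamma> = 1/2\<close>.
\<close>

section \<open>A Fourier integral of a power function\<close>

lemma nn_integral_powr_exp:
  fixes p r :: real
  assumes "0 < p" "0 < r"
  shows "(\<integral>\<^sup>+x. ennreal (indicator {0<..} x * (x powr (p - 1) * exp (- (r * x)))) \<partial>lborel)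
           = ennreal (Gamma p * r powr (- p))"
proof -
  have "ennreal (Gamma p) = (\<integral>\<^sup>+x. ennreal (indicator {0..} x * x powr (p - 1) / exp x) \<partial>lborel)"
    using Gamma_conv_nn_integral_real[OF assms(1)] .
  also have "\<dots> = ennreal r * (\<integral>\<^sup>+x. ennreal (indicator {0..} (r * x) * (r * x) powr (p - 1) / exp (r * x)) \<partial>lborel)"
    using assms by (subst nn_integral_real_affine[where c=r and t=0]) auto
  also have "\<dots> = ennreal r * (\<integral>\<^sup>+x. ennreal (r powr (p - 1)) * ennreal (indicator {0<..} x * (x powr (p - 1) * exp (- (r * x)))) \<partial>lborel)"
  proof (intro arg_cong2[where f="(*)"] nn_integral_cong refl)
    fix x :: real
    show "ennreal (indicator {0..} (r * x) * (r * x) powr (p - 1) / exp (r * x)) =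
          ennreal (r powr (p - 1)) * ennreal (indicator {0<..} x * (x powr (p - 1) * exp (- (r * x))))"
      using assms
      by (cases "x > 0")
         (auto simp: indicator_def zero_le_mult_iff powr_mult exp_minus field_simps simp flip: ennreal_mult')
  qed
  also have "\<dots> = ennreal (r powr p) * (\<integral>\<^sup>+x. ennreal (indicator {0<..} x * (x powr (p - 1) * exp (- (r * x)))) \<partial>lborel)"
    using assms
    by (subst nn_integral_cmult) (auto simp: powr_diff mult.assoc[symmetric] simp flip: ennreal_mult')
  finally have "ennreal (r powr (-p)) * ennreal (Gamma p) = ennreal (r powr (-p)) * ennreal (r powr p) *
      (\<integral>\<^sup>+x. ennreal (indicator {0<..} x * (x powr (p - 1) * exp (- (r * x)))) \<partial>lborel)"
    by (simp add: mult.assoc)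
  moreover have "ennreal (r powr (-p)) * ennreal (r powr p) = 1"
    using assms by (simp add: powr_minus flip: ennreal_mult')
  ultimately show ?thesis
    using assms by (simp add: mult.commute flip: ennreal_mult')
qed

lemma nn_integral_exp_Ioi:
  fixes c :: real
  assumes "0 < c"
  shows "(\<integral>\<^sup>+x. ennreal (indicator {0<..} x * exp (- (c * x))) \<partial>lborel) = ennreal (1 / c)"
proof -
  have "(\<integral>\<^sup>+x. ennreal (indicator {0<..} x * exp (- (c * x))) \<partial>lborel) =
        (\<integral>\<^sup>+x. ennreal (indicator {0<..} x * (x powr (1 - 1) * exp (- (c * x)))) \<partial>lborel)"
    by (intro nn_integral_cong) (auto simp: indicator_def)
  then show ?thesis
    using nn_integral_powr_exp[of 1 c] assms by (simp add: powr_minus inverse_eq_divide)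
qed

lemma Gamma_reflection_real:
  fixes x :: real
  assumes "x \<notin> \<int>"
  shows "Gamma x * Gamma (1 - x) = pi / sin (pi * x)"
proof -
  have "complex_of_real (Gamma x * Gamma (1 - x)) = Gamma (of_real x) * Gamma (1 - of_real x)"
    by (metis Gamma_complex_of_real of_real_1 of_real_diff of_real_mult)
  also have "\<dots> = of_real (pi / sin (pi * x))"
    unfolding Gamma_reflection_complex by (simp add: sin_of_real flip: of_real_mult)
  finally show ?thesis by (simp only: of_real_eq_iff)
qed

text \<open>Writing \<open>1 / (1 + u)\<close> as the integral of \<open>exp (- (1 + u) r)\<close> over \<open>r > 0\<close>
  and exchanging the integrals gives \<open>\<Gamma>(p) \<Gamma>(1 - p)\<close>.\<close>

lemma nn_integral_powr_div_1_plus: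
  fixes p :: real
  assumes "0 < p" "p < 1"
  shows "(\<integral>\<^sup>+u. ennreal (indicator {0<..} u * (u powr (p - 1) / (1 + u))) \<partial>lborel)
           = ennreal (pi / sin (pi * p))"
proof -
  have *: "p \<notin> \<int>" using assms by (auto elim!: Ints_cases)
  let ?I = "indicator {0<..} :: real \<Rightarrow> real"
  have "(\<integral>\<^sup>+u. ennreal (?I u * (u powr (p - 1) / (1 + u))) \<partial>lborel)
     = (\<integral>\<^sup>+u. \<integral>\<^sup>+r. ennreal (?I u * u powr (p - 1)) * ennreal (?I r * exp (- ((1 + u) * r))) \<partial>lborel \<partial>lborel)"
  proof (intro nn_integral_cong)
    fix u :: real
    show "ennreal (?I u * (u powr (p - 1) / (1 + u))) =
       (\<integral>\<^sup>+r. ennreal (?I u * u powr (p - 1)) * ennreal (?I r * exp (- ((1 + u) * r))) \<partial>lborel)"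
      using nn_integral_exp_Ioi[of "1 + u"]
      by (cases "u > 0") (simp_all add: nn_integral_cmult, (simp flip: ennreal_mult')?)
  qed
  also have "\<dots> = (\<integral>\<^sup>+r. \<integral>\<^sup>+u. ennreal (?I u * u powr (p - 1)) * ennreal (?I r * exp (- ((1 + u) * r))) \<partial>lborel \<partial>lborel)"
    by (rule lborel_pair.Fubini') simp
  also have "\<dots> = (\<integral>\<^sup>+r. ennreal (Gamma p) * ennreal (?I r * (r powr ((1 - p) - 1) * exp (- (1 * r)))) \<partial>lborel)"
  proof (intro nn_integral_cong)
    fix r :: real
    have "(\<integral>\<^sup>+u. ennreal (?I u * u powr (p - 1)) * ennreal (?I r * exp (- ((1 + u) * r))) \<partial>lborel) =
       (\<integral>\<^sup>+u. ennreal (?I r * exp (- r)) * ennreal (?I u * (u powr (p - 1) * exp (- (r * u)))) \<partial>lborel)"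
      by (intro nn_integral_cong)
         (auto simp: indicator_def algebra_simps exp_add exp_diff exp_minus divide_inverse simp flip: ennreal_mult')
    also have "\<dots> = ennreal (Gamma p) * ennreal (?I r * (r powr ((1 - p) - 1) * exp (- (1 * r))))"
      using nn_integral_powr_exp[of p r] assms
      by (cases "r > 0") (simp_all add: nn_integral_cmult, (simp add: mult_ac flip: ennreal_mult')?)
    finally show "(\<integral>\<^sup>+u. ennreal (?I u * u powr (p - 1)) * ennreal (?I r * exp (- ((1 + u) * r))) \<partial>lborel) = \<dots>" .
  qed
  also have "\<dots> = ennreal (Gamma p) * ennreal (Gamma (1 - p) * 1 powr (- (1 - p)))"
    using assms nn_integral_powr_exp[of "1 - p" 1] by (simp add: nn_integral_cmult)
  also have "\<dots> = ennreal (pi / sin (pi * p))"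
    using Gamma_reflection_real[OF *] assms by (simp flip: ennreal_mult')
  finally show ?thesis .
qed

lemma nn_integral_Ioi_substitute_square:
  fixes f :: "real \<Rightarrow> real"
  assumes [measurable]: "f \<in> borel_measurable borel" and nonneg: "\<And>u. 0 < u \<Longrightarrow> 0 \<le> f u"
    and c: "0 \<le> c" and I: "(\<integral>\<^sup>+u. ennreal (indicator {0<..} u * f u) \<partial>lborel) = ennreal c"
  shows "(\<integral>\<^sup>+s. ennreal (indicator {0<..} s * (2 * s * f (s\<^sup>2))) \<partial>lborel) = ennreal c"
proof -
  have im: "(\<lambda>s::real. s\<^sup>2) ` {0<..} = {0<..}"
  proof (intro equalityI subsetI)
    fix y :: real assume "y \<in> {0<..}"
    then have "y = (sqrt y)\<^sup>2" "sqrt y \<in> {0<..}" by auto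
    then show "y \<in> (\<lambda>s::real. s\<^sup>2) ` {0<..}" by (rule image_eqI)
  qed auto
  have hb: "has_bochner_integral lborel (\<lambda>u. indicator {0<..} u * f u) c"
    using c I nonneg by (intro has_bochner_integral_nn_integral) (auto simp: indicator_def)
  then have si: "set_integrable lborel {0<..} f" and sv: "(LINT u:{0<..}|lborel. f u) = c"
    by (auto simp: set_integrable_def set_lebesgue_integral_def has_bochner_integral_iff)
  have "f absolutely_integrable_on {0<..}"
    using si by (simp add: set_integrable_def integrable_completion)
  moreover have "integral {0<..} f = c"
    using set_borel_integral_eq_integral(2)[OF si] sv by simp
  ultimately have ai: "f absolutely_integrable_on ((\<lambda>s. s\<^sup>2) ` {0<..}) \<and> integral ((\<lambda>s. s\<^sup>2) ` {0<..}) f = c"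
    by (simp add: im)
  have "(\<lambda>s. \<bar>2 * s\<bar> * f (s\<^sup>2)) absolutely_integrable_on {0<..} \<and>
           integral {0<..} (\<lambda>s. \<bar>2 * s\<bar> * f (s\<^sup>2)) = c"
    by (subst has_absolute_integral_change_of_variables_1'[OF _ _ _])
       (auto intro!: derivative_eq_intros inj_onI ai simp: ai power2_eq_iff)
  then have "((\<lambda>s. \<bar>2 * s\<bar> * f (s\<^sup>2)) has_integral c) {0<..}"
    using set_lebesgue_integral_eq_integral(1) by (auto simp: has_integral_iff)
  from nn_integral_has_integral_lebesgue[OF _ this]
  have "(\<integral>\<^sup>+s. ennreal (indicator {0<..} s * (\<bar>2 * s\<bar> * f (s\<^sup>2))) \<partial>lborel) = ennreal c"
    using nonneg by auto
  then show ?thesis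
    by (subst nn_integral_cong[where v="\<lambda>s. ennreal (indicator {0<..} s * (\<bar>2 * s\<bar> * f (s\<^sup>2)))"])
       (auto simp: indicator_def)
qed

lemma nn_integral_powr_div_1_plus_square:
  fixes \<alpha> :: real
  assumes "0 < \<alpha>" "\<alpha> < 2"
  shows "(\<integral>\<^sup>+s. ennreal (indicator {0<..} s * (s powr (\<alpha> - 1) / (1 + s\<^sup>2))) \<partial>lborel)
           = ennreal (pi / (2 * sin (pi * \<alpha> / 2)))"
proof -
  have pos: "0 < sin (pi * \<alpha> / 2)" using assms by (intro sin_gt_zero) auto
  have "(\<integral>\<^sup>+s. ennreal (indicator {0<..} s * (2 * s * ((s\<^sup>2) powr (\<alpha> / 2 - 1) / (1 + s\<^sup>2)))) \<partial>lborel)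
         = ennreal (pi / sin (pi * (\<alpha> / 2)))"
    using assms pos
    by (intro nn_integral_Ioi_substitute_square nn_integral_powr_div_1_plus) auto
  moreover have "indicator {0<..} s * (2 * s * ((s\<^sup>2) powr (\<alpha> / 2 - 1) / (1 + s\<^sup>2))) =
      2 * (indicator {0<..} s * (s powr (\<alpha> - 1) / (1 + s\<^sup>2)))" for s :: real
  proof (cases "s > 0")
    case True
    then have "s * (s\<^sup>2) powr (\<alpha> / 2 - 1) = s powr 1 * (s powr 2) powr (\<alpha> / 2 - 1)" by simp
    also have "\<dots> = s powr (\<alpha> - 1)"
      unfolding powr_powr powr_add[symmetric] by (simp add: algebra_simps)
    finally show ?thesis using True by (simp add: field_simps)
  qed auto
  ultimately have "(\<integral>\<^sup>+s. ennreal 2 * ennreal (indicator {0<..} s * (s powr (\<alpha> - 1) / (1 + s\<^sup>2))) \<partial>lborel)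
     = ennreal (pi / sin (pi * (\<alpha> / 2)))"
    by (simp only: ennreal_mult' [of 2, symmetric] zero_le_numeral)
  then have "2 * (\<integral>\<^sup>+s. ennreal (indicator {0<..} s * (s powr (\<alpha> - 1) / (1 + s\<^sup>2))) \<partial>lborel)
     = ennreal (pi / sin (pi * (\<alpha> / 2)))"
    by (subst (asm) nn_integral_cmult) auto
  also have "\<dots> = 2 * ennreal (pi / (2 * sin (pi * \<alpha> / 2)))"
    using pos by (simp flip: ennreal_numeral ennreal_mult')
  finally show ?thesis
    by (simp add: ennreal_mult_cancel_left)
qed

lemma nn_integral_one_minus_cos_exp:
  fixes s :: real
  assumes s: "0 < s"
  shows "(\<integral>\<^sup>+x. ennreal (indicator {0<..} x * ((1 - cos x) * exp (- (s * x)))) \<partial>lborel)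
           = ennreal (1 / (s * (1 + s\<^sup>2)))"
proof -
  have nz: "1 + s\<^sup>2 \<noteq> 0" by (metis add_pos_nonneg less_numeral_extra(1,3) zero_le_power2)
  define F where "F = (\<lambda>x. - exp (- (s * x)) / s + exp (- (s * x)) * (s * cos x - sin x) / (1 + s\<^sup>2))"
  have "(F \<longlongrightarrow> 0 + 0) at_top"
    unfolding F_def
  proof (rule tendsto_add)
    have e: "((\<lambda>x. exp (- (s * x))) \<longlongrightarrow> 0) at_top" using s by real_asymp
    then show "((\<lambda>x. - exp (- (s * x)) / s) \<longlongrightarrow> 0) at_top"
      using tendsto_divide[OF tendsto_minus[OF e] tendsto_const, of s] s by simp
    have "((\<lambda>x. exp (- (s * x)) * ((s + 1) / (1 + s\<^sup>2))) \<longlongrightarrow> 0) at_top"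
      using tendsto_mult_right[OF e, of "(s + 1) / (1 + s\<^sup>2)"] by simp
    moreover have "\<forall>x. norm (exp (- (s * x)) * (s * cos x - sin x) / (1 + s\<^sup>2)) \<le> exp (- (s * x)) * ((s + 1) / (1 + s\<^sup>2))"
    proof
      fix x
      have "\<bar>s * cos x - sin x\<bar> \<le> \<bar>s * cos x\<bar> + \<bar>sin x\<bar>" by (rule abs_triangle_ineq4)
      also have "\<dots> \<le> s * 1 + 1" using s by (intro add_mono) (auto simp: abs_mult)
      finally show "norm (exp (- (s * x)) * (s * cos x - sin x) / (1 + s\<^sup>2)) \<le> exp (- (s * x)) * ((s + 1) / (1 + s\<^sup>2))"
        by (auto simp: abs_mult intro!: divide_right_mono)
    qed
    ultimately show "((\<lambda>x. exp (- (s * x)) * (s * cos x - sin x) / (1 + s\<^sup>2)) \<longlongrightarrow> 0) at_top"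
      by (rule Lim_null_comparison[OF always_eventually, rotated])
  qed
  moreover have "(F has_real_derivative (1 - cos x) * exp (- (s * x))) (at x)" for x
  proof -
    define w where "w = inverse (1 + s\<^sup>2)"
    have w: "w * (1 + s\<^sup>2) = 1" using nz by (simp add: w_def)
    have "F = (\<lambda>x. - exp (- (s * x)) / s + w * (exp (- (s * x)) * (s * cos x - sin x)))"
      by (auto simp: F_def w_def divide_inverse)
    moreover have "((\<lambda>x. - exp (- (s * x)) / s + w * (exp (- (s * x)) * (s * cos x - sin x))) has_real_derivative
        exp (- (s * x)) - (w * (1 + s\<^sup>2)) * cos x * exp (- (s * x))) (at x)"
      using s by (auto intro!: derivative_eq_intros simp: algebra_simps power2_eq_square)
    ultimately show ?thesis by (simp only: w left_diff_distrib mult_1_left)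
  qed
  ultimately have "(\<integral>\<^sup>+x. ennreal ((1 - cos x) * exp (- (s * x))) * indicator {0..} x \<partial>lborel) = ennreal (0 - F 0)"
    by (intro nn_integral_FTC_atLeast) auto
  moreover have "0 - F 0 = 1 / (s * (1 + s\<^sup>2))"
    unfolding F_def using s nz by (simp add: field_simps power2_eq_square)
  moreover have "(\<integral>\<^sup>+x. ennreal (indicator {0<..} x * ((1 - cos x) * exp (- (s * x)))) \<partial>lborel) =
     (\<integral>\<^sup>+x. ennreal ((1 - cos x) * exp (- (s * x))) * indicator {0..} x \<partial>lborel)"
    by (intro nn_integral_cong) (auto simp: indicator_def)
  ultimately show ?thesis by simp
qed

text \<open>The power of \<open>x\<close> is, up to the factor \<open>\<Gamma>(1 + \<alpha>)\<close>, the Laplace transform of \<open>s\<^sup>\<alpha>\<close>.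
  After the exchange of integrals the inner one is the Laplace transform of \<open>1 - cos x\<close>, namely
  \<open>1 / (s (1 + s\<^sup>2))\<close>. All integrands are nonnegative, so Tonelli applies for every
  \<open>\<alpha>\<close> in \<open>(0, 2)\<close> at once.\<close>

lemma nn_integral_one_minus_cos_powr:
  fixes \<alpha> :: real
  assumes \<alpha>: "0 < \<alpha>" "\<alpha> < 2"
  shows "(\<integral>\<^sup>+x. ennreal (indicator {0<..} x * ((1 - cos x) * x powr (- 1 - \<alpha>))) \<partial>lborel)
           = ennreal (pi / (2 * Gamma (1 + \<alpha>) * sin (pi * \<alpha> / 2)))"
proof -
  let ?I = "indicator {0<..} :: real \<Rightarrow> real"
  have G: "0 < Gamma (1 + \<alpha>)" using \<alpha> by simp
  have "ennreal (Gamma (1 + \<alpha>)) * (\<integral>\<^sup>+x. ennreal (?I x * ((1 - cos x) * x powr (- 1 - \<alpha>))) \<partial>lborel)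
    = (\<integral>\<^sup>+x. ennreal (Gamma (1 + \<alpha>)) * ennreal (?I x * ((1 - cos x) * x powr (- 1 - \<alpha>))) \<partial>lborel)"
    by (simp add: nn_integral_cmult)
  also have "\<dots> = (\<integral>\<^sup>+x. \<integral>\<^sup>+s. ennreal (?I x * (1 - cos x)) * ennreal (?I s * (s powr (1 + \<alpha> - 1) * exp (- (x * s)))) \<partial>lborel \<partial>lborel)"
  proof (intro nn_integral_cong)
    fix x :: real
    show "ennreal (Gamma (1 + \<alpha>)) * ennreal (?I x * ((1 - cos x) * x powr (- 1 - \<alpha>))) =
      (\<integral>\<^sup>+s. ennreal (?I x * (1 - cos x)) * ennreal (?I s * (s powr (1 + \<alpha> - 1) * exp (- (x * s)))) \<partial>lborel)"
      using nn_integral_powr_exp[of "1 + \<alpha>" x] \<alpha>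
      by (cases "x > 0")
         (simp_all add: nn_integral_cmult, (simp add: mult_ac flip: ennreal_mult')?)
  qed
  also have "\<dots> = (\<integral>\<^sup>+s. \<integral>\<^sup>+x. ennreal (?I x * (1 - cos x)) * ennreal (?I s * (s powr (1 + \<alpha> - 1) * exp (- (x * s)))) \<partial>lborel \<partial>lborel)"
    by (rule lborel_pair.Fubini') simp
  also have "\<dots> = (\<integral>\<^sup>+s. ennreal (?I s * (s powr (\<alpha> - 1) / (1 + s\<^sup>2))) \<partial>lborel)"
  proof (intro nn_integral_cong)
    fix s :: real
    have "(\<integral>\<^sup>+x. ennreal (?I x * (1 - cos x)) * ennreal (?I s * (s powr (1 + \<alpha> - 1) * exp (- (x * s)))) \<partial>lborel)
      = (\<integral>\<^sup>+x. ennreal (?I s * s powr \<alpha>) * ennreal (?I x * ((1 - cos x) * exp (- (s * x)))) \<partial>lborel)"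
      by (intro nn_integral_cong) (auto simp: indicator_def mult_ac simp flip: ennreal_mult')
    also have "\<dots> = ennreal (?I s * (s powr (\<alpha> - 1) / (1 + s\<^sup>2)))"
      using nn_integral_one_minus_cos_exp[of s]
      by (cases "s > 0")
         (simp_all add: nn_integral_cmult, (simp add: powr_diff flip: ennreal_mult')?)
    finally show "(\<integral>\<^sup>+x. ennreal (?I x * (1 - cos x)) * ennreal (?I s * (s powr (1 + \<alpha> - 1) * exp (- (x * s)))) \<partial>lborel) = \<dots>" .
  qed
  also have "\<dots> = ennreal (Gamma (1 + \<alpha>)) * ennreal (pi / (2 * Gamma (1 + \<alpha>) * sin (pi * \<alpha> / 2)))"
    using nn_integral_powr_div_1_plus_square[OF \<alpha>] G by (simp flip: ennreal_mult')
  finally show ?thesis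
    using G by (simp add: ennreal_mult_cancel_left)
qed

section \<open>Convergence of tails from convergence of Levy exponents\<close>

definition tilt_weight :: "real \<Rightarrow> real" where
  "tilt_weight x = 1 - exp (- x\<^sup>2 / 2)"

lemma tilt_weight_nonneg: "0 \<le> tilt_weight x"
  by (simp add: tilt_weight_def)

lemma tilt_weight_pos: "x \<noteq> 0 \<Longrightarrow> 0 < tilt_weight x"
  by (simp add: tilt_weight_def)

lemma tilt_weight_tail: "1 < \<bar>x\<bar> \<Longrightarrow> 1 - exp (- 1 / 2) \<le> tilt_weight x"
  using power_mono[of 1 "\<bar>x\<bar>" 2] by (simp add: tilt_weight_def)

lemma tilt_weight_measurable [measurable]: "tilt_weight \<in> borel_measurable borel"
  unfolding tilt_weight_def[abs_def] by measurable

text \<open>The reason for this choice of weight: as a normal average of \<open>1 - cos (t * x)\<close> it is accessible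
  through the exponent of a measure, and it vanishes only at the origin. A finite combination of
  such terms would not do, because it is almost periodic and comes arbitrarily close to \<open>0\<close> again
  far from the origin.\<close>

lemma tilt_weight_conv_expectation:
  "tilt_weight x = (\<integral>t. (1 - cos (t * x)) \<partial>std_normal_distribution)"
proof -
  interpret Q: real_distribution std_normal_distribution by (rule real_dist_normal_dist)
  have i: "complex_integrable std_normal_distribution (\<lambda>t. iexp (x * t))"
    by (intro Q.integrable_iexp) auto
  have "exp (- x\<^sup>2 / 2) = Re (char std_normal_distribution x)"
    by (simp add: char_std_normal_distribution)
  also have "\<dots> = (\<integral>t. Re (iexp (x * t)) \<partial>std_normal_distribution)"
    unfolding char_def using i by (rule integral_Re[symmetric])
  also have "\<dots> = (\<integral>t. cos (t * x) \<partial>std_normal_distribution)"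
    by (simp add: Re_exp mult.commute)
  finally have "(\<integral>t. cos (t * x) \<partial>std_normal_distribution) = exp (- x\<^sup>2 / 2)" ..
  moreover have "integrable std_normal_distribution (\<lambda>t. cos (t * x))"
    by (intro Q.integrable_const_bound[where B=1]) auto
  ultimately show ?thesis
    using Q.prob_space by (simp add: tilt_weight_def)
qed

lemma integrable_std_normal_quadratic:
  assumes "g \<in> borel_measurable borel" "\<And>t. \<bar>g t\<bar> \<le> K * (1 + t\<^sup>2)"
  shows "integrable std_normal_distribution (g :: real \<Rightarrow> real)"
proof (rule Bochner_Integration.integrable_bound)
  interpret Q: real_distribution std_normal_distribution by (rule real_dist_normal_dist)
  show "integrable std_normal_distribution (\<lambda>t. K * (1 + t\<^sup>2))"
    by (intro integrable_mult_right Bochner_Integration.integrable_add integrable_std_normal_distribution_moment Q.integrable_const)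
  show "AE t in std_normal_distribution. norm (g t) \<le> norm (K * (1 + t\<^sup>2))"
    using assms(2) by (auto intro!: order.trans[OF assms(2)])
qed (use assms in simp)

text \<open>A measure of infinite total mass is allowed, as long as it integrates \<open>1 - cos (t * x)\<close>. The
  quadratic growth of these integrals makes their normal averages finite; it holds for every Levy
  measure, and an atom at the origin is harmless since all integrands vanish there.\<close>

locale symmetric_levy_measure = sigma_finite_measure M for M :: "real measure" +
  assumes sets_eq_borel [measurable_cong]: "sets M = sets borel"
    and symmetric: "distr M borel uminus = M"
    and integrable_one_minus_cos: "\<And>t. integrable M (\<lambda>x. 1 - cos (t * x))"
    and exponent_quadratic: "\<exists>K. \<forall>t. (\<integral>x. (1 - cos (t * x)) \<partial>M) \<le> K * (1 + t\<^sup>2)"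
begin

lemma space_eq [simp]: "space M = UNIV"
  using sets_eq_borel[THEN sets_eq_imp_space_eq] by simp

definition exponent :: "real \<Rightarrow> real" where
  "exponent t = (\<integral>x. (1 - cos (t * x)) \<partial>M)"

lemma exponent_nonneg: "0 \<le> exponent t"
  unfolding exponent_def by (intro Bochner_Integration.integral_nonneg) auto

lemma exponent_measurable [measurable]: "exponent \<in> borel_measurable borel"
  unfolding exponent_def[abs_def] by measurable

lemma integral_odd_eq_0:
  assumes [measurable]: "g \<in> borel_measurable borel" and odd: "\<And>x. g (- x) = - (g x :: real)"
  shows "(\<integral>x. g x \<partial>M) = 0"
proof -
  have "(\<integral>x. g x \<partial>M) = (\<integral>x. g x \<partial>distr M borel uminus)" by (simp add: symmetric)
  also have "\<dots> = (\<integral>x. g (- x) \<partial>M)" by (rule integral_distr) auto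
  also have "\<dots> = - (\<integral>x. g x \<partial>M)" by (simp add: odd)
  finally show ?thesis by simp
qed

lemma one_minus_cos_mult_cos:
  "(1 - cos (t * x)) * cos (u * x)
     = ((1 - cos ((u + t) * x)) + (1 - cos ((u - t) * x))) / 2 - (1 - cos (u * (x :: real)))"
proof -
  have "cos ((u + t) * x) + cos ((u - t) * x) = 2 * (cos (t * x) * cos (u * x))"
    by (simp add: distrib_right left_diff_distrib cos_add cos_diff)
  then show ?thesis by (simp add: field_simps)
qed

lemma integral_one_minus_cos_mult_cos:
  "(\<integral>x. (1 - cos (t * x)) * cos (u * x) \<partial>M) = (exponent (u + t) + exponent (u - t)) / 2 - exponent u"
  unfolding one_minus_cos_mult_cos
  by (intro has_bochner_integral_integral_eq has_bochner_integral_diff has_bochner_integral_divide_zero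
        has_bochner_integral_add)
     (auto simp: exponent_def has_bochner_integral_iff integrable_one_minus_cos)

text \<open>The Fourier transform of the weighted measure depends on the measure through its exponent only:
  exchange the integral with the normal average that defines the weight, and expand
  \<open>(1 - cos (t * x)) * cos (u * x)\<close> by the product formula.\<close>

lemma
  shows integrable_tilt_weight: "integrable M tilt_weight" (is ?int)
    and integral_tilt_weight_cos: "(\<integral>x. tilt_weight x * cos (u * x) \<partial>M) =
      (\<integral>t. (exponent (u + t) + exponent (u - t)) / 2 - exponent u \<partial>std_normal_distribution)" (is ?eq)
proof -
  interpret Q: real_distribution std_normal_distribution by (rule real_dist_normal_dist)
  interpret P: pair_sigma_finite std_normal_distribution M ..
  have int: "integrable (std_normal_distribution \<Otimes>\<^sub>M M) (\<lambda>(t, x). (1 - cos (t * x)) * cos (u * x))" for u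
  proof (rule P.Fubini_integrable)
    have dom: "norm ((1 - cos (t * x)) * cos (u * x)) \<le> 1 - cos (t * x)" for t x :: real
      using mult_left_mono[OF abs_cos_le_one[of "u * x"], of "1 - cos (t * x)"] by (simp add: abs_mult)
    have i: "integrable M (\<lambda>x. (1 - cos (t * x)) * cos (u * x))" for t
      by (rule Bochner_Integration.integrable_bound[OF integrable_one_minus_cos[of t]])
         (use dom in auto)
    then show "AE t in std_normal_distribution. integrable M (\<lambda>x. case (t, x) of (t, x) \<Rightarrow> (1 - cos (t * x)) * cos (u * x))"
      by simp
    obtain K where K: "\<And>t. exponent t \<le> K * (1 + t\<^sup>2)"
      using exponent_quadratic by (auto simp: exponent_def)
    have "integrable std_normal_distribution (\<lambda>t. \<integral>x. norm ((1 - cos (t * x)) * cos (u * x)) \<partial>M)"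
    proof (rule integrable_std_normal_quadratic)
      fix t
      have "(\<integral>x. norm ((1 - cos (t * x)) * cos (u * x)) \<partial>M) \<le> exponent t"
        unfolding exponent_def using i integrable_one_minus_cos dom
        by (intro integral_mono) auto
      then show "\<bar>\<integral>x. norm ((1 - cos (t * x)) * cos (u * x)) \<partial>M\<bar> \<le> K * (1 + t\<^sup>2)"
        using K[of t] by (simp add: order.trans[OF _ K])
    qed measurable
    then show "integrable std_normal_distribution (\<lambda>t. \<integral>x. norm (case (t, x) of (t, x) \<Rightarrow> (1 - cos (t * x)) * cos (u * x)) \<partial>M)"
      by simp
  qed (auto simp: case_prod_beta')
  have inner: "(\<integral>t. (1 - cos (t * x)) * cos (u * x) \<partial>std_normal_distribution) = tilt_weight x * cos (u * x)" for x u
    by (simp add: tilt_weight_conv_expectation)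
  show ?int
    using P.integrable_snd[OF int[of 0]] inner[of _ 0] by simp
  have "(\<integral>x. (\<integral>t. (1 - cos (t * x)) * cos (u * x) \<partial>std_normal_distribution) \<partial>M) =
        (\<integral>t. (\<integral>x. (1 - cos (t * x)) * cos (u * x) \<partial>M) \<partial>std_normal_distribution)"
    by (rule P.Fubini_integral) (rule int)
  then show ?eq
    by (simp only: inner integral_one_minus_cos_mult_cos)
qed

definition tilt_mass :: real where
  "tilt_mass = (\<integral>x. tilt_weight x \<partial>M)"

definition tilt :: "real measure" where
  "tilt = density M (\<lambda>x. ennreal (tilt_weight x / tilt_mass))"

lemma tilt_mass_pos_if_tail_pos:
  assumes "0 < measure M {x. 1 < \<bar>x\<bar>}"
  shows "0 < tilt_mass"
proof -
  have fin: "emeasure M {x. 1 < \<bar>x\<bar>} < \<infinity>"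
    using assms by (cases "emeasure M {x. 1 < \<bar>x\<bar>} = \<infinity>") (auto simp: measure_def less_top)
  define c :: real where "c = 1 - exp (- 1 / 2)"
  have c: "0 < c" by (simp add: c_def)
  have "0 < c * measure M {x. 1 < \<bar>x\<bar>}" using assms c by simp
  also have "\<dots> = (\<integral>x. c * indicator {x. 1 < \<bar>x\<bar>} x \<partial>M)" by simp
  also have "\<dots> \<le> tilt_mass"
    unfolding tilt_mass_def
  proof (intro integral_mono integrable_tilt_weight integrable_mult_right)
    show "integrable M (indicat_real {x. 1 < \<bar>x\<bar>})" using fin by (intro integrable_real_indicator) auto
    show "c * indicator {x. 1 < \<bar>x\<bar>} x \<le> tilt_weight x" for x
      using tilt_weight_tail[of x] tilt_weight_nonneg[of x] by (auto simp: indicator_def c_def)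
  qed
  finally show ?thesis .
qed

context
  assumes mass_pos: "0 < tilt_mass"
begin

lemma real_distribution_tilt: "real_distribution tilt"
proof -
  have "emeasure tilt UNIV = (\<integral>\<^sup>+x. ennreal (tilt_weight x / tilt_mass) \<partial>M)"
    by (simp add: tilt_def emeasure_density)
  also have "\<dots> = ennreal (\<integral>x. tilt_weight x / tilt_mass \<partial>M)"
    using integrable_tilt_weight mass_pos tilt_weight_nonneg
    by (intro nn_integral_eq_integral) auto
  also have "\<dots> = 1" using mass_pos by (simp add: tilt_mass_def)
  finally have "emeasure tilt (space tilt) = 1" by (simp add: tilt_def)
  then have "prob_space tilt" by (rule prob_spaceI)
  then show ?thesis
    by (auto simp: real_distribution_def real_distribution_axioms_def tilt_def sets_eq_borel)
qed

lemma integral_tilt: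
  fixes f :: "real \<Rightarrow> 'b :: {banach, second_countable_topology}"
  assumes [measurable]: "f \<in> borel_measurable borel"
  shows "(\<integral>x. f x \<partial>tilt) = (\<integral>x. (tilt_weight x / tilt_mass) *\<^sub>R f x \<partial>M)"
  unfolding tilt_def using mass_pos tilt_weight_nonneg by (intro integral_density) auto

text \<open>The sine part vanishes by symmetry, so the characteristic function is known from the cosine
  transform in \<open>integral_tilt_weight_cos\<close>.\<close>

lemma char_tilt:
  "char tilt u = complex_of_real ((\<integral>x. tilt_weight x * cos (u * x) \<partial>M) / tilt_mass)"
proof -
  interpret T: real_distribution tilt by (rule real_distribution_tilt)
  have i: "complex_integrable tilt (\<lambda>x. iexp (u * x))"
    by (intro T.integrable_iexp) auto
  have "Re (char tilt u) = (\<integral>x. Re (iexp (u * x)) \<partial>tilt)"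
    unfolding char_def using i by (rule integral_Re[symmetric])
  also have "\<dots> = (\<integral>x. cos (u * x) \<partial>tilt)" by (simp add: Re_exp)
  also have "\<dots> = (\<integral>x. tilt_weight x * cos (u * x) / tilt_mass \<partial>M)"
    by (subst integral_tilt) auto
  finally have re: "Re (char tilt u) = (\<integral>x. tilt_weight x * cos (u * x) \<partial>M) / tilt_mass" by simp
  have "Im (char tilt u) = (\<integral>x. Im (iexp (u * x)) \<partial>tilt)"
    unfolding char_def using i by (rule integral_Im[symmetric])
  also have "\<dots> = (\<integral>x. sin (u * x) \<partial>tilt)" by (simp add: Im_exp)
  also have "\<dots> = (\<integral>x. tilt_weight x * sin (u * x) / tilt_mass \<partial>M)"
    by (subst integral_tilt) auto
  also have "\<dots> = 0"
    by (intro integral_odd_eq_0) (auto simp: tilt_weight_def)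
  finally have im: "Im (char tilt u) = 0" .
  show ?thesis by (rule complex_eqI) (simp_all add: re im)
qed

lemma integral_tilt_tail:
  "(\<integral>x. indicator {x. 1 < \<bar>x\<bar>} x / tilt_weight x \<partial>tilt) = measure M {x. 1 < \<bar>x\<bar>} / tilt_mass"
proof -
  have "(\<integral>x. indicator {x. 1 < \<bar>x\<bar>} x / tilt_weight x \<partial>tilt) =
        (\<integral>x. (tilt_weight x / tilt_mass) *\<^sub>R (indicator {x. 1 < \<bar>x\<bar>} x / tilt_weight x) \<partial>M)"
    by (rule integral_tilt) auto
  also have "\<dots> = (\<integral>x. indicator {x. 1 < \<bar>x\<bar>} x / tilt_mass \<partial>M)"
  proof (intro Bochner_Integration.integral_cong refl)
    fix x :: real
    show "(tilt_weight x / tilt_mass) *\<^sub>R (indicator {x. 1 < \<bar>x\<bar>} x / tilt_weight x) =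
        indicator {x. 1 < \<bar>x\<bar>} x / tilt_mass"
      using tilt_weight_pos[of x] by (cases "x = 0") auto
  qed
  finally show ?thesis by simp
qed

end

end

text \<open>The continuity theorem for Levy measures. The bound makes dominated convergence applicable to
  the normal averages, so the weighted and normalised measures converge weakly; the tail is the
  integral of a function that is bounded and continuous except at \<open>-1\<close> and \<open>1\<close>. Positivity of
  the limiting tail guarantees that the normalisation is possible, in the limit and hence for all
  large indices.\<close>

lemma levy_tail_continuity:
  fixes M :: "nat \<Rightarrow> real measure" and M' :: "real measure"
  assumes levy: "\<And>n. symmetric_levy_measure (M n)" and levy': "symmetric_levy_measure M'"
    and exponent_tendsto: "\<And>t. (\<lambda>n. symmetric_levy_measure.exponent (M n) t)
          \<longlonglongrightarrow> symmetric_levy_measure.exponent M' t"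
    and exponent_bound: "\<And>n t. symmetric_levy_measure.exponent (M n) t \<le> K * (1 + t\<^sup>2)"
    and no_atoms: "emeasure M' {- 1, 1} = 0" and tail_pos: "0 < measure M' {x. 1 < \<bar>x\<bar>}"
  shows "(\<lambda>n. measure (M n) {x. 1 < \<bar>x\<bar>}) \<longlonglongrightarrow> measure M' {x. 1 < \<bar>x\<bar>}"
proof -
  interpret L: symmetric_levy_measure "M n" for n by (rule levy)
  interpret L': symmetric_levy_measure M' by (rule levy')
  interpret Q: real_distribution std_normal_distribution by (rule real_dist_normal_dist)
  have cos_tendsto: "(\<lambda>n. \<integral>x. tilt_weight x * cos (u * x) \<partial>M n) \<longlonglongrightarrow> (\<integral>x. tilt_weight x * cos (u * x) \<partial>M')" for u
    unfolding L.integral_tilt_weight_cos L'.integral_tilt_weight_cos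
  proof (rule integral_dominated_convergence)
    let ?B = "\<lambda>t. K * (1 + (u + t)\<^sup>2) + K * (1 + (u - t)\<^sup>2) + K * (1 + u\<^sup>2)"
    have "integrable std_normal_distribution (\<lambda>t. 3 * K + 3 * K * u\<^sup>2 + 2 * K * t\<^sup>2)"
      by (intro integrable_mult_right Bochner_Integration.integrable_add integrable_std_normal_distribution_moment Q.integrable_const)
    moreover have "?B = (\<lambda>t. 3 * K + 3 * K * u\<^sup>2 + 2 * K * t\<^sup>2)"
      by (auto simp: power2_eq_square algebra_simps)
    ultimately show "integrable std_normal_distribution ?B" by simp
    show "AE t in std_normal_distribution.
        (\<lambda>n. (L.exponent n (u + t) + L.exponent n (u - t)) / 2 - L.exponent n u)
          \<longlonglongrightarrow> (L'.exponent (u + t) + L'.exponent (u - t)) / 2 - L'.exponent u"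
      by (intro AE_I2 tendsto_intros exponent_tendsto) auto
    show "AE t in std_normal_distribution.
        norm ((L.exponent n (u + t) + L.exponent n (u - t)) / 2 - L.exponent n u) \<le> ?B t" for n
    proof (rule AE_I2)
      fix t
      have aux: "\<bar>(a + b) / 2 - c\<bar> \<le> a' + b' + c'"
        if "0 \<le> a" "0 \<le> b" "0 \<le> c" "a \<le> a'" "b \<le> b'" "c \<le> c'" for a b c a' b' c' :: real
        using that by (intro abs_leI) argo+
      show "norm ((L.exponent n (u + t) + L.exponent n (u - t)) / 2 - L.exponent n u) \<le> ?B t"
        unfolding real_norm_def by (intro aux exponent_bound L.exponent_nonneg)
    qed
  qed measurable
  have mass': "0 < L'.tilt_mass" using tail_pos by (rule L'.tilt_mass_pos_if_tail_pos)
  have mass_tendsto: "(\<lambda>n. L.tilt_mass n) \<longlonglongrightarrow> L'.tilt_mass"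
    using cos_tendsto[of 0] by (simp add: L.tilt_mass_def L'.tilt_mass_def)
  then have "eventually (\<lambda>n. 0 < L.tilt_mass n) sequentially"
    using mass' by (rule order_tendstoD)
  then obtain n0 where n0: "\<And>n. 0 < L.tilt_mass (n + n0)"
    unfolding eventually_sequentially by (meson le_add2)
  \<comment> \<open>The theorem of Levy needs a probability measure at every index, hence the shift by \<open>n0\<close>.\<close>
  have "weak_conv_m (\<lambda>n. L.tilt (n + n0)) L'.tilt"
  proof (rule levy_continuity)
    show "(\<lambda>n. char (L.tilt (n + n0)) t) \<longlonglongrightarrow> char L'.tilt t" for t
      unfolding L.char_tilt[OF n0] L'.char_tilt[OF mass']
      using mass'
      by (intro tendsto_of_real tendsto_divide LIMSEQ_ignore_initial_segment[OF cos_tendsto]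
          LIMSEQ_ignore_initial_segment[OF mass_tendsto]) auto
  qed (auto intro: L.real_distribution_tilt L'.real_distribution_tilt n0 mass')
  let ?g = "\<lambda>x. indicator {x. 1 < \<bar>x\<bar>} x / tilt_weight x"
  have disc: "{x. \<not> isCont ?g x} \<subseteq> {- 1, 1}"
  proof (rule subsetI, rule ccontr)
    fix x :: real assume x: "x \<in> {x. \<not> isCont ?g x}" "x \<notin> {- 1, 1}"
    then consider "\<bar>x\<bar> < 1" | "1 < \<bar>x\<bar>" by force
    then have "isCont ?g x"
    proof cases
      case 1
      have "eventually (\<lambda>y. y \<in> {y. \<bar>y\<bar> < 1}) (nhds x)"
        using 1 by (intro eventually_nhds_in_open open_Collect_less continuous_intros) auto
      then have "eventually (\<lambda>y. ?g y = 0) (nhds x)"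
        by eventually_elim auto
      then show ?thesis using isCont_cong by fastforce
    next
      case 2
      have "eventually (\<lambda>y. y \<in> {y. 1 < \<bar>y\<bar>}) (nhds x)"
        using 2 by (intro eventually_nhds_in_open open_Collect_less continuous_intros) auto
      then have ev: "eventually (\<lambda>y. ?g y = 1 / tilt_weight y) (nhds x)"
        by eventually_elim auto
      have "tilt_weight x \<noteq> 0" using 2 tilt_weight_pos[of x] by force
      then have "isCont (\<lambda>y. 1 / tilt_weight y) x"
        unfolding tilt_weight_def by (intro continuous_intros) auto
      then show ?thesis using isCont_cong[OF ev] by blast
    qed
    then show False using x by simp
  qed
  have null: "emeasure L'.tilt {- 1, 1} = 0"
    unfolding L'.tilt_def using no_atoms
    by (intro absolutely_continuousI_density[unfolded absolutely_continuous_def, THEN subsetD, THEN null_setsD1])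
       (auto simp: null_sets_def L'.sets_eq_borel)
  have "(\<lambda>n. \<integral>x. ?g x \<partial>L.tilt (n + n0)) \<longlonglongrightarrow> (\<integral>x. ?g x \<partial>L'.tilt)"
  proof (rule weak_conv_imp_bdd_ae_continuous_conv[OF L.real_distribution_tilt[OF n0] L'.real_distribution_tilt[OF mass'] \<open>weak_conv_m _ _\<close>])
    show "emeasure L'.tilt {x. \<not> isCont ?g x} = 0"
      using emeasure_mono[OF disc, of L'.tilt] null by (simp add: L'.tilt_def L'.sets_eq_borel)
    show "norm (?g x) \<le> 1 / (1 - exp (- 1 / 2))" for x
    proof (cases "1 < \<bar>x\<bar>")
      case True
      have "1 / tilt_weight x \<le> 1 / (1 - exp (- 1 / 2))"
        by (rule divide_left_mono[OF tilt_weight_tail[OF True]])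
           (use True tilt_weight_pos[of x] in \<open>auto intro!: mult_pos_pos\<close>)
      then show ?thesis using True tilt_weight_nonneg[of x] by simp
    qed simp
  qed measurable
  then have "(\<lambda>n. measure (M (n + n0)) {x. 1 < \<bar>x\<bar>} / L.tilt_mass (n + n0))
      \<longlonglongrightarrow> measure M' {x. 1 < \<bar>x\<bar>} / L'.tilt_mass"
    unfolding L.integral_tilt_tail[OF n0] L'.integral_tilt_tail[OF mass'] .
  from tendsto_mult[OF this LIMSEQ_ignore_initial_segment[OF mass_tendsto, of n0]]
  have "(\<lambda>n. measure (M (n + n0)) {x. 1 < \<bar>x\<bar>}) \<longlonglongrightarrow> measure M' {x. 1 < \<bar>x\<bar>}"
    using n0[THEN less_imp_neq] mass'[THEN less_imp_neq] by simp
  then show ?thesis by (rule LIMSEQ_offset)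
qed

section \<open>The Levy measure with a power density\<close>

lemma nn_integral_even:
  fixes f :: "real \<Rightarrow> ennreal"
  assumes [measurable]: "f \<in> borel_measurable borel" and even: "\<And>x. f (- x) = f x"
  shows "(\<integral>\<^sup>+x. f x \<partial>lborel) = 2 * (\<integral>\<^sup>+x. f x * indicator {0<..} x \<partial>lborel)"
proof -
  have "(\<integral>\<^sup>+x. f x \<partial>lborel) = (\<integral>\<^sup>+x. f x * indicator {0<..} x + f x * indicator {..<0} x \<partial>lborel)"
    using AE_lborel_singleton[of "0 :: real"]
    by (intro nn_integral_cong_AE, eventually_elim) (auto simp: indicator_def)
  also have "\<dots> = (\<integral>\<^sup>+x. f x * indicator {0<..} x \<partial>lborel) + (\<integral>\<^sup>+x. f x * indicator {..<0} x \<partial>lborel)"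
    by (rule nn_integral_add) auto
  also have "(\<integral>\<^sup>+x. f x * indicator {..<0} x \<partial>lborel) = (\<integral>\<^sup>+x. f (- x) * indicator {..<0} (- x) \<partial>lborel)"
    by (subst nn_integral_real_affine[where c="-1" and t=0]) auto
  also have "\<dots> = (\<integral>\<^sup>+x. f x * indicator {0<..} x \<partial>lborel)"
    by (intro nn_integral_cong) (auto simp: even indicator_def)
  finally show ?thesis by (simp add: mult_2)
qed

definition power_levy_measure :: "real \<Rightarrow> real \<Rightarrow> real measure" where
  "power_levy_measure c \<alpha> = density lborel (\<lambda>x. ennreal (c * \<bar>x\<bar> powr (- 1 - \<alpha>)))"

lemma sets_power_levy_measure [measurable_cong, simp]: "sets (power_levy_measure c \<alpha>) = sets borel"
  by (simp add: power_levy_measure_def)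

lemma space_power_levy_measure [simp]: "space (power_levy_measure c \<alpha>) = UNIV"
  by (simp add: power_levy_measure_def)

text \<open>The value of the integral in \<open>nn_integral_one_minus_cos_powr\<close>.\<close>

definition one_minus_cos_moment :: "real \<Rightarrow> real" where
  "one_minus_cos_moment \<alpha> = pi / (2 * Gamma (1 + \<alpha>) * sin (pi * \<alpha> / 2))"

lemma one_minus_cos_moment_pos: "0 < \<alpha> \<Longrightarrow> \<alpha> < 2 \<Longrightarrow> 0 < one_minus_cos_moment \<alpha>"
  unfolding one_minus_cos_moment_def by (intro divide_pos_pos mult_pos_pos sin_gt_zero) auto

text \<open>The substitution \<open>x \<mapsto> t * x\<close> extracts the factor \<open>\<bar>t\<bar> powr \<alpha>\<close>, and evenness reduces
  the case \<open>t = 1\<close> to the half-line.\<close>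

lemma power_levy_one_minus_cos:
  assumes \<alpha>: "0 < \<alpha>" "\<alpha> < 2" and c: "0 < c"
  shows "has_bochner_integral (power_levy_measure c \<alpha>) (\<lambda>x. 1 - cos (t * x))
           (2 * c * one_minus_cos_moment \<alpha> * \<bar>t\<bar> powr \<alpha>)"
proof (rule has_bochner_integral_nn_integral)
  let ?f = "\<lambda>t x :: real. ennreal (c * ((1 - cos (t * x)) * \<bar>x\<bar> powr (- 1 - \<alpha>)))"
  have dens: "(\<integral>\<^sup>+x. ennreal (1 - cos (t * x)) \<partial>power_levy_measure c \<alpha>) = (\<integral>\<^sup>+x. ?f t x \<partial>lborel)"
    unfolding power_levy_measure_def using c
    by (subst nn_integral_density) (auto intro!: nn_integral_cong simp: mult_ac simp flip: ennreal_mult')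
  have unit: "(\<integral>\<^sup>+x. ?f 1 x \<partial>lborel) = ennreal (2 * c * one_minus_cos_moment \<alpha>)"
  proof -
    have "(\<integral>\<^sup>+x. ?f 1 x \<partial>lborel) = 2 * (\<integral>\<^sup>+x. ?f 1 x * indicator {0<..} x \<partial>lborel)"
      by (rule nn_integral_even) auto
    also have "(\<integral>\<^sup>+x. ?f 1 x * indicator {0<..} x \<partial>lborel) =
        (\<integral>\<^sup>+x. ennreal c * ennreal (indicator {0<..} x * ((1 - cos x) * x powr (- 1 - \<alpha>))) \<partial>lborel)"
      using c by (intro nn_integral_cong) (auto simp: indicator_def simp flip: ennreal_mult')
    also have "\<dots> = ennreal c * ennreal (one_minus_cos_moment \<alpha>)"
      by (subst nn_integral_cmult) (auto simp: nn_integral_one_minus_cos_powr[OF \<alpha>] one_minus_cos_moment_def)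
    also have "2 * \<dots> = ennreal (2 * c * one_minus_cos_moment \<alpha>)"
      using c by (simp add: mult.assoc ennreal_mult')
    finally show ?thesis .
  qed
  have "(\<integral>\<^sup>+x. ?f t x \<partial>lborel) = ennreal (2 * c * one_minus_cos_moment \<alpha> * \<bar>t\<bar> powr \<alpha>)"
  proof (cases "t = 0")
    case False
    have scale: "\<bar>t\<bar> * \<bar>t\<bar> powr (- 1 - \<alpha>) = \<bar>t\<bar> powr (- \<alpha>)"
      using False by (simp add: powr_mult_base)
    have "ennreal (2 * c * one_minus_cos_moment \<alpha>) = (\<integral>\<^sup>+x. ?f 1 x \<partial>lborel)" by (rule unit[symmetric])
    also have "\<dots> = ennreal \<bar>t\<bar> * (\<integral>\<^sup>+x. ?f 1 (t * x) \<partial>lborel)"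
      using False by (subst nn_integral_real_affine[where c=t and t=0]) auto
    also have "(\<lambda>x. ?f 1 (t * x)) = (\<lambda>x. ennreal (\<bar>t\<bar> powr (- 1 - \<alpha>)) * ?f t x)"
      using c by (auto simp: abs_mult powr_mult mult_ac simp flip: ennreal_mult')
    also have "(\<integral>\<^sup>+x. ennreal (\<bar>t\<bar> powr (- 1 - \<alpha>)) * ?f t x \<partial>lborel) = ennreal (\<bar>t\<bar> powr (- 1 - \<alpha>)) * (\<integral>\<^sup>+x. ?f t x \<partial>lborel)"
      by (rule nn_integral_cmult) auto
    also have "ennreal \<bar>t\<bar> * \<dots> = ennreal (\<bar>t\<bar> powr (- \<alpha>)) * (\<integral>\<^sup>+x. ?f t x \<partial>lborel)"
      unfolding scale[symmetric] by (simp add: ennreal_mult' mult.assoc)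
    finally have "ennreal (\<bar>t\<bar> powr \<alpha>) * ennreal (2 * c * one_minus_cos_moment \<alpha>) =
        ennreal (\<bar>t\<bar> powr \<alpha>) * ennreal (\<bar>t\<bar> powr (- \<alpha>)) * (\<integral>\<^sup>+x. ?f t x \<partial>lborel)"
      by (simp only: mult.assoc)
    moreover have "ennreal (\<bar>t\<bar> powr \<alpha>) * ennreal (\<bar>t\<bar> powr (- \<alpha>)) = 1"
      using False by (simp add: powr_minus flip: ennreal_mult')
    ultimately show ?thesis
      by (simp add: mult.commute flip: ennreal_mult')
  qed simp
  then show "(\<integral>\<^sup>+x. ennreal (1 - cos (t * x)) \<partial>power_levy_measure c \<alpha>) =
      ennreal (2 * c * one_minus_cos_moment \<alpha> * \<bar>t\<bar> powr \<alpha>)"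
    by (simp only: dens)
  show "0 \<le> 2 * c * one_minus_cos_moment \<alpha> * \<bar>t\<bar> powr \<alpha>"
    using c one_minus_cos_moment_pos[OF \<alpha>] by simp
qed auto

lemma powr_le_one_plus_square:
  fixes t :: real
  assumes "0 < \<alpha>" "\<alpha> < 2"
  shows "\<bar>t\<bar> powr \<alpha> \<le> 1 + t\<^sup>2"
proof (cases "\<bar>t\<bar> \<le> 1")
  case True
  then have "\<bar>t\<bar> powr \<alpha> \<le> 1" using assms by (simp add: powr_le1)
  then show ?thesis using zero_le_power2[of t] by linarith
next
  case False
  then have "\<bar>t\<bar> powr \<alpha> \<le> \<bar>t\<bar> powr 2" using assms by (intro powr_mono) auto
  then show ?thesis using False by simp
qed

lemma symmetric_levy_measure_power:
  assumes \<alpha>: "0 < \<alpha>" "\<alpha> < 2" and c: "0 < c"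
  shows "symmetric_levy_measure (power_levy_measure c \<alpha>)"
proof (intro symmetric_levy_measure.intro symmetric_levy_measure_axioms.intro)
  show "sigma_finite_measure (power_levy_measure c \<alpha>)"
    unfolding power_levy_measure_def by (subst sigma_finite_measure.sigma_finite_iff_density_finite[OF sigma_finite_lborel]) auto
  show "distr (power_levy_measure c \<alpha>) borel uminus = power_levy_measure c \<alpha>"
  proof (rule measure_eqI)
    fix A assume "A \<in> sets (distr (power_levy_measure c \<alpha>) borel uminus)"
    then have [measurable]: "A \<in> sets borel" by simp
    have "emeasure (power_levy_measure c \<alpha>) A = (\<integral>\<^sup>+x. ennreal (c * \<bar>x\<bar> powr (- 1 - \<alpha>)) * indicator A x \<partial>lborel)"
      by (simp add: power_levy_measure_def emeasure_density)
    also have "\<dots> = (\<integral>\<^sup>+x. ennreal (c * \<bar>x\<bar> powr (- 1 - \<alpha>)) * indicator (uminus -` A) x \<partial>lborel)"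
      by (subst nn_integral_real_affine[where c="-1" and t=0]) (auto intro!: nn_integral_cong simp: indicator_def)
    also have "\<dots> = emeasure (power_levy_measure c \<alpha>) (uminus -` A)"
      using measurable_sets[of uminus borel borel A]
      by (simp add: power_levy_measure_def emeasure_density)
    also have "\<dots> = emeasure (distr (power_levy_measure c \<alpha>) borel uminus) A"
      by (simp add: emeasure_distr)
    finally show "emeasure (distr (power_levy_measure c \<alpha>) borel uminus) A = emeasure (power_levy_measure c \<alpha>) A" ..
  qed simp
  note hb = power_levy_one_minus_cos[OF \<alpha> c]
  show "integrable (power_levy_measure c \<alpha>) (\<lambda>x. 1 - cos (t * x))" for t
    using hb by (simp add: has_bochner_integral_iff)
  show "\<exists>K. \<forall>t. (\<integral>x. (1 - cos (t * x)) \<partial>power_levy_measure c \<alpha>) \<le> K * (1 + t\<^sup>2)"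
    using hb c one_minus_cos_moment_pos[OF \<alpha>] powr_le_one_plus_square[OF \<alpha>]
    by (intro exI[of _ "2 * c * one_minus_cos_moment \<alpha>"] allI)
       (simp add: has_bochner_integral_iff)
qed simp

lemma exponent_power_levy:
  assumes "0 < \<alpha>" "\<alpha> < 2" "0 < c"
  shows "symmetric_levy_measure.exponent (power_levy_measure c \<alpha>) t = 2 * c * one_minus_cos_moment \<alpha> * \<bar>t\<bar> powr \<alpha>"
  unfolding symmetric_levy_measure.exponent_def[OF symmetric_levy_measure_power[OF assms]]
  using power_levy_one_minus_cos[OF assms] by (simp add: has_bochner_integral_iff)

lemma power_levy_tail:
  assumes \<alpha>: "0 < \<alpha>" and c: "0 < c"
  shows "measure (power_levy_measure c \<alpha>) {x. 1 < \<bar>x\<bar>} = 2 * c / \<alpha>"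
proof -
  have lim: "((\<lambda>x. - (c / \<alpha>) * x powr (- \<alpha>)) \<longlongrightarrow> 0) at_top"
    using \<alpha> tendsto_mult_right_zero[OF tendsto_neg_powr[of "- \<alpha>" "\<lambda>x. x" at_top], of "- (c / \<alpha>)"]
    by (simp add: filterlim_ident)
  have "emeasure (power_levy_measure c \<alpha>) {x. 1 < \<bar>x\<bar>} =
      (\<integral>\<^sup>+x. ennreal (c * \<bar>x\<bar> powr (- 1 - \<alpha>)) * indicator {x. 1 < \<bar>x\<bar>} x \<partial>lborel)"
    by (simp add: power_levy_measure_def emeasure_density)
  also have "\<dots> = 2 * (\<integral>\<^sup>+x. ennreal (c * \<bar>x\<bar> powr (- 1 - \<alpha>)) * indicator {x. 1 < \<bar>x\<bar>} x * indicator {0<..} x \<partial>lborel)"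
    by (rule nn_integral_even) (auto simp: indicator_def)
  also have "(\<integral>\<^sup>+x. ennreal (c * \<bar>x\<bar> powr (- 1 - \<alpha>)) * indicator {x. 1 < \<bar>x\<bar>} x * indicator {0<..} x \<partial>lborel)
     = (\<integral>\<^sup>+x. ennreal (c * x powr (- 1 - \<alpha>)) * indicator {1..} x \<partial>lborel)"
    using AE_lborel_singleton[of "1 :: real"]
    by (intro nn_integral_cong_AE, eventually_elim) (auto simp: indicator_def)
  also have "\<dots> = ennreal (0 - (- (c / \<alpha>) * 1 powr (- \<alpha>)))"
    using c \<alpha> lim
    by (intro nn_integral_FTC_atLeast[where F="\<lambda>x. - (c / \<alpha>) * x powr (- \<alpha>)"])
       (auto intro!: derivative_eq_intros simp: field_simps minus_diff_commute)
  also have "2 * \<dots> = ennreal (2 * c / \<alpha>)"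
    using c \<alpha> by (simp flip: ennreal_numeral ennreal_mult')
  finally show ?thesis using c \<alpha> by (simp add: measure_def)
qed

lemma power_levy_no_atoms: "emeasure (power_levy_measure c \<alpha>) {- 1, 1} = 0"
proof -
  have "(\<integral>\<^sup>+x. ennreal (c * \<bar>x\<bar> powr (- 1 - \<alpha>)) * indicator {- 1, 1} x \<partial>lborel) = (\<integral>\<^sup>+x. 0 \<partial>(lborel :: real measure))"
    using AE_lborel_singleton[of "1 :: real"] AE_lborel_singleton[of "- 1 :: real"]
    by (intro nn_integral_cong_AE, eventually_elim) (auto simp: indicator_def)
  then show ?thesis by (simp add: power_levy_measure_def emeasure_density)
qed

section \<open>A Tauberian theorem for symmetric laws\<close>

definition scaled_law :: "real measure \<Rightarrow> real \<Rightarrow> real \<Rightarrow> real measure" where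
  "scaled_law N r b = density (distr N borel (\<lambda>y. y / b)) (\<lambda>_. ennreal r)"

lemma sets_scaled_law [simp, measurable_cong]: "sets (scaled_law N r b) = sets borel"
  by (simp add: scaled_law_def)

lemma (in real_distribution) emeasure_scaled_law:
  assumes [measurable]: "A \<in> sets borel"
  shows "emeasure (scaled_law M r b) A = ennreal r * emeasure M ((\<lambda>y. y / b) -` A)"
  by (simp add: scaled_law_def emeasure_density_const emeasure_distr)

lemma (in real_distribution) integral_cos_eq_Re_char: "(\<integral>y. cos (t * y) \<partial>M) = Re (char M t)"
proof -
  have i: "complex_integrable M (\<lambda>x. iexp (t * x))" by (intro integrable_iexp) auto
  show ?thesis
    unfolding char_def using integral_Re[OF i] by (simp add: Re_exp)
qed

lemma (in real_distribution) scaled_law_one_minus_cos: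
  assumes "0 < r"
  shows "has_bochner_integral (scaled_law M r b) (\<lambda>x. 1 - cos (t * x)) (r * (1 - Re (char M (t / b))))"
proof -
  have i: "integrable M (\<lambda>y. cos (t * (y / b)))"
    by (intro integrable_const_bound[where B=1]) auto
  have int: "integrable M (\<lambda>y. r * (1 - cos (t * (y / b))))"
    using i by simp
  have "(\<integral>y. r * (1 - cos (t * (y / b))) \<partial>M) = r * (1 - Re (char M (t / b)))"
    using i integral_cos_eq_Re_char[of "t / b"] prob_space by simp
  with int have *: "has_bochner_integral M (\<lambda>y. r * (1 - cos (t * (y / b)))) (r * (1 - Re (char M (t / b))))"
    by (simp add: has_bochner_integral_iff)
  have "has_bochner_integral (distr M borel (\<lambda>y. y / b)) (\<lambda>x. r *\<^sub>R (1 - cos (t * x))) (r * (1 - Re (char M (t / b))))"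
    by (rule has_bochner_integral_distr) (use * in auto)
  then show ?thesis
    unfolding scaled_law_def using assms by (intro has_bochner_integral_density) auto
qed

lemma (in real_distribution) symmetric_levy_measure_scaled_law:
  assumes sym: "distr M borel uminus = M" and r: "0 < r"
  shows "symmetric_levy_measure (scaled_law M r b)"
proof (intro symmetric_levy_measure.intro symmetric_levy_measure_axioms.intro)
  have "finite_measure (scaled_law M r b)"
  proof (rule finite_measureI)
    have "emeasure (scaled_law M r b) UNIV = ennreal r"
      using emeasure_space_1 by (simp add: emeasure_scaled_law)
    then show "emeasure (scaled_law M r b) (space (scaled_law M r b)) \<noteq> \<infinity>"
      by (simp add: scaled_law_def)
  qed
  then show "sigma_finite_measure (scaled_law M r b)"
    by (rule finite_measure.axioms(1))
  show "distr (scaled_law M r b) borel uminus = scaled_law M r b"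
  proof (rule measure_eqI)
    fix A assume "A \<in> sets (distr (scaled_law M r b) borel uminus)"
    then have [measurable]: "A \<in> sets borel" by simp
    let ?B = "(\<lambda>y. y / b) -` A"
    have B: "?B \<in> sets borel" using measurable_sets[of "\<lambda>y. y / b" borel borel A] by simp
    have A': "uminus -` A \<in> sets borel" using measurable_sets[of uminus borel borel A] by simp
    have "emeasure (distr (scaled_law M r b) borel uminus) A = emeasure (scaled_law M r b) (uminus -` A)"
      by (simp add: emeasure_distr scaled_law_def)
    also have "\<dots> = ennreal r * emeasure M (uminus -` ?B)"
      using A' by (simp add: emeasure_scaled_law vimage_def)
    also have "emeasure M (uminus -` ?B) = emeasure (distr M borel uminus) ?B"
      using B by (simp add: emeasure_distr)
    also have "\<dots> = emeasure M ?B" by (simp add: sym)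
    also have "ennreal r * \<dots> = emeasure (scaled_law M r b) A" by (simp add: emeasure_scaled_law)
    finally show "emeasure (distr (scaled_law M r b) borel uminus) A = emeasure (scaled_law M r b) A" .
  qed simp
  note hb = scaled_law_one_minus_cos[OF r, of b]
  show "integrable (scaled_law M r b) (\<lambda>x. 1 - cos (t * x))" for t
    using hb by (simp add: has_bochner_integral_iff)
  have "r * (1 - Re (char M t)) \<le> (2 * r) * (1 + s\<^sup>2)" for s t
  proof -
    have "\<bar>Re (char M t)\<bar> \<le> 1" using abs_Re_le_cmod[of "char M t"] cmod_char_le_1[of t] by linarith
    then have "r * (1 - Re (char M t)) \<le> r * 2" using r by (intro mult_left_mono) auto
    moreover have "0 \<le> r * s\<^sup>2" using r by simp
    ultimately show ?thesis unfolding distrib_left by linarith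
  qed
  then show "\<exists>K. \<forall>t. (\<integral>x. (1 - cos (t * x)) \<partial>scaled_law M r b) \<le> K * (1 + t\<^sup>2)"
    using hb by (intro exI[of _ "2 * r"] allI) (simp add: has_bochner_integral_iff)
qed simp

lemma (in real_distribution) exponent_scaled_law:
  assumes "distr M borel uminus = M" "0 < r"
  shows "symmetric_levy_measure.exponent (scaled_law M r b) t = r * (1 - Re (char M (t / b)))"
  unfolding symmetric_levy_measure.exponent_def[OF symmetric_levy_measure_scaled_law[OF assms]]
  using scaled_law_one_minus_cos[OF assms(2)] by (simp add: has_bochner_integral_iff)

lemma (in real_distribution) scaled_law_tail:
  assumes "0 < r" "0 < b"
  shows "measure (scaled_law M r b) {x. 1 < \<bar>x\<bar>} = r * measure M {y. b < \<bar>y\<bar>}"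
proof -
  have "(\<lambda>y. y / b) -` {x. 1 < \<bar>x\<bar>} = {y. b < \<bar>y\<bar>}"
    using assms(2) by (auto simp: field_simps)
  then show ?thesis
    using assms(1) by (simp add: measure_def emeasure_scaled_law enn2real_mult)
qed

text \<open>The asymptotics control a neighbourhood of \<open>0\<close>; outside it the left-hand side is at most \<open>2\<close>.
  The resulting global bound is the domination required by \<open>levy_tail_continuity\<close>.\<close>

lemma (in real_distribution) one_minus_Re_char_le_powr:
  assumes \<alpha>: "0 < \<alpha>"
    and lim: "((\<lambda>t. (1 - Re (char M t)) / \<bar>t\<bar> powr \<alpha>) \<longlongrightarrow> a) (at 0)"
  shows "\<exists>C>0. \<forall>t. 1 - Re (char M t) \<le> C * \<bar>t\<bar> powr \<alpha>"
proof -
  have le2: "1 - Re (char M t) \<le> 2" for t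
    using abs_Re_le_cmod[of "char M t"] cmod_char_le_1[of t] by linarith
  have "eventually (\<lambda>t. (1 - Re (char M t)) / \<bar>t\<bar> powr \<alpha> < \<bar>a\<bar> + 1) (at 0)"
    using lim by (rule order_tendstoD) simp
  then obtain d where d: "0 < d" and
    near: "\<And>t. t \<noteq> 0 \<Longrightarrow> \<bar>t\<bar> < d \<Longrightarrow> (1 - Re (char M t)) / \<bar>t\<bar> powr \<alpha> < \<bar>a\<bar> + 1"
    by (auto simp: eventually_at dist_real_def)
  define C where "C = max (\<bar>a\<bar> + 1) (2 / d powr \<alpha>)"
  have C: "0 < C" by (simp add: C_def)
  have "1 - Re (char M t) \<le> C * \<bar>t\<bar> powr \<alpha>" for t
  proof -
    consider "t = 0" | "t \<noteq> 0" "\<bar>t\<bar> < d" | "d \<le> \<bar>t\<bar>" by force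
    then show ?thesis
    proof cases
      case 1
      then show ?thesis by (simp add: char_zero)
    next
      case 2
      then have "1 - Re (char M t) \<le> (\<bar>a\<bar> + 1) * \<bar>t\<bar> powr \<alpha>"
        using near[of t] by (simp add: field_simps)
      also have "\<dots> \<le> C * \<bar>t\<bar> powr \<alpha>" by (intro mult_right_mono) (auto simp: C_def)
      finally show ?thesis .
    next
      case 3
      have "2 = 2 / d powr \<alpha> * d powr \<alpha>" using d by simp
      also have "\<dots> \<le> C * \<bar>t\<bar> powr \<alpha>"
        using 3 d \<alpha> C by (intro mult_mono powr_mono2) (auto simp: C_def)
      finally show ?thesis using le2[of t] by linarith
    qed
  qed
  with C show ?thesis by blast
qed

text \<open>Pitman's theorem. It suffices to let \<open>x\<close> run through a sequence \<open>b n\<close>. The laws rescaled by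
  \<open>b n\<close> and multiplied by \<open>b n powr \<alpha>\<close> have exponents that converge to \<open>a * \<bar>t\<bar> powr \<alpha>\<close>,
  and their mass outside \<open>[-1, 1]\<close> is the quantity whose limit is sought.\<close>

lemma (in real_distribution) tail_asymptotics_of_char:
  assumes sym: "distr M borel uminus = M" and \<alpha>: "0 < \<alpha>" "\<alpha> < 2" and a: "0 < a"
    and lim: "((\<lambda>t. (1 - Re (char M t)) / \<bar>t\<bar> powr \<alpha>) \<longlongrightarrow> a) (at 0)"
  shows "((\<lambda>x. x powr \<alpha> * measure M {y. x < \<bar>y\<bar>}) \<longlongrightarrow> 2 * a * Gamma \<alpha> * sin (pi * \<alpha> / 2) / pi) at_top"
proof (rule tendsto_at_topI_sequentially)
  fix X :: "nat \<Rightarrow> real" assume X: "filterlim X at_top sequentially"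
  \<comment> \<open>The scales have to be positive at every index, not only eventually.\<close>
  define b where "b n = (if 0 < X n then X n else 1)" for n
  have bpos: "0 < b n" for n by (simp add: b_def)
  have "eventually (\<lambda>n. 0 < X n) sequentially" using X by (simp add: filterlim_at_top_dense)
  then have bX: "eventually (\<lambda>n. X n = b n) sequentially" by eventually_elim (simp add: b_def)
  have b: "filterlim b at_top sequentially"
    using filterlim_cong[OF refl refl bX] X by simp
  have rpos: "0 < b n powr \<alpha>" for n using bpos[of n] by simp
  \<comment> \<open>Chosen so that the power density has exponent \<open>a * \<bar>t\<bar> powr \<alpha>\<close>.\<close>
  define c where "c = a / (2 * one_minus_cos_moment \<alpha>)"
  have c: "0 < c" using a one_minus_cos_moment_pos[OF \<alpha>] by (simp add: c_def)
  have ca: "2 * c * one_minus_cos_moment \<alpha> = a"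
    using one_minus_cos_moment_pos[OF \<alpha>] by (simp add: c_def)
  obtain C where C: "0 < C" "\<And>t. 1 - Re (char M t) \<le> C * \<bar>t\<bar> powr \<alpha>"
    using one_minus_Re_char_le_powr[OF \<alpha>(1) lim] by auto
  have scale: "b n powr \<alpha> * \<bar>t / b n\<bar> powr \<alpha> = \<bar>t\<bar> powr \<alpha>" for n t
    using bpos[of n] by (simp add: powr_divide abs_divide)
  have "(\<lambda>n. measure (scaled_law M (b n powr \<alpha>) (b n)) {x. 1 < \<bar>x\<bar>})
      \<longlonglongrightarrow> measure (power_levy_measure c \<alpha>) {x. 1 < \<bar>x\<bar>}"
  proof (rule levy_tail_continuity)
    show "symmetric_levy_measure (scaled_law M (b n powr \<alpha>) (b n))" for n
      by (rule symmetric_levy_measure_scaled_law[OF sym rpos])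
    show "symmetric_levy_measure (power_levy_measure c \<alpha>)"
      by (rule symmetric_levy_measure_power[OF \<alpha> c])
    show "(\<lambda>n. symmetric_levy_measure.exponent (scaled_law M (b n powr \<alpha>) (b n)) t)
        \<longlonglongrightarrow> symmetric_levy_measure.exponent (power_levy_measure c \<alpha>) t" for t
      unfolding exponent_scaled_law[OF sym rpos] exponent_power_levy[OF \<alpha> c] ca
    proof (cases "t = 0")
      case False
      have "filterlim (\<lambda>n. t / b n) (at 0) sequentially"
        unfolding filterlim_at using False bpos
        by (auto intro!: tendsto_divide_0[OF tendsto_const] filterlim_at_top_imp_at_infinity[OF b] always_eventually simp: less_imp_neq[THEN not_sym])
      from filterlim_compose[OF lim this]
      have "(\<lambda>n. \<bar>t\<bar> powr \<alpha> * ((1 - Re (char M (t / b n))) / \<bar>t / b n\<bar> powr \<alpha>)) \<longlonglongrightarrow> \<bar>t\<bar> powr \<alpha> * a"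
        by (rule tendsto_mult_left)
      moreover have "\<bar>t\<bar> powr \<alpha> * ((1 - Re (char M (t / b n))) / \<bar>t / b n\<bar> powr \<alpha>) =
          b n powr \<alpha> * (1 - Re (char M (t / b n)))" for n
        using False bpos[of n] unfolding scale[of n t, symmetric] by simp
      ultimately show "(\<lambda>n. b n powr \<alpha> * (1 - Re (char M (t / b n)))) \<longlonglongrightarrow> a * \<bar>t\<bar> powr \<alpha>"
        by (simp only: mult.commute[of a])
    qed (simp add: char_zero)
    show "symmetric_levy_measure.exponent (scaled_law M (b n powr \<alpha>) (b n)) t \<le> C * (1 + t\<^sup>2)" for n t
    proof -
      have "b n powr \<alpha> * (1 - Re (char M (t / b n))) \<le> b n powr \<alpha> * (C * \<bar>t / b n\<bar> powr \<alpha>)"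
        using C(2)[of "t / b n"] by (intro mult_left_mono) auto
      also have "\<dots> = C * \<bar>t\<bar> powr \<alpha>" using scale[of n t] by (simp add: mult.left_commute)
      also have "\<dots> \<le> C * (1 + t\<^sup>2)"
        using C(1) powr_le_one_plus_square[OF \<alpha>] by (intro mult_left_mono) auto
      finally show ?thesis unfolding exponent_scaled_law[OF sym rpos] .
    qed
    show "0 < measure (power_levy_measure c \<alpha>) {x. 1 < \<bar>x\<bar>}"
      using \<alpha> c by (simp add: power_levy_tail)
  qed (rule power_levy_no_atoms)
  then have "(\<lambda>n. b n powr \<alpha> * measure M {y. b n < \<bar>y\<bar>}) \<longlonglongrightarrow> 2 * c / \<alpha>"
    unfolding scaled_law_tail[OF rpos bpos] power_levy_tail[OF \<alpha>(1) c] .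
  moreover have "2 * c / \<alpha> = 2 * a * Gamma \<alpha> * sin (pi * \<alpha> / 2) / pi"
  proof -
    have "Gamma (1 + \<alpha>) = \<alpha> * Gamma \<alpha>"
      using Gamma_plus1[of \<alpha>] nonpos_Ints_nonpos[of \<alpha>] \<alpha> by (auto simp: add.commute)
    then show ?thesis using \<alpha> by (simp add: c_def one_minus_cos_moment_def)
  qed
  moreover have "eventually (\<lambda>n. b n powr \<alpha> * measure M {y. b n < \<bar>y\<bar>} = X n powr \<alpha> * measure M {y. X n < \<bar>y\<bar>}) sequentially"
    using bX by eventually_elim simp
  ultimately show "(\<lambda>n. X n powr \<alpha> * measure M {y. X n < \<bar>y\<bar>}) \<longlonglongrightarrow> 2 * a * Gamma \<alpha> * sin (pi * \<alpha> / 2) / pi"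
    by (auto intro: Lim_transform_eventually)
qed

section \<open>The characteristic function near the origin, and the tail\<close>

lemma tendsto_one_minus_exp_uminus:
  assumes "(f \<longlongrightarrow> 0) F" and "((\<lambda>x. f x / g x) \<longlongrightarrow> l) F"
  shows "((\<lambda>x. (1 - exp (- f x :: real)) / g x) \<longlongrightarrow> l) F"
proof -
  \<comment> \<open>The continuous extension of the difference quotient, since \<open>f\<close> may take the value \<open>0\<close>.\<close>
  define h :: "real \<Rightarrow> real" where "h y = (if y = 0 then 1 else (1 - exp (- y)) / y)" for y
  have "((\<lambda>y :: real. (1 - exp (- y)) / y) \<longlongrightarrow> 1) (at 0)"
    by real_asymp
  then have "(h \<longlongrightarrow> 1) (at 0)"
    by (rule Lim_transform_eventually) (auto simp: h_def eventually_at_filter)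
  then have "isCont h 0" by (simp add: isCont_def h_def)
  from isCont_tendsto_compose[OF this assms(1)]
  have "((\<lambda>x. h (f x)) \<longlongrightarrow> 1) F" by (simp add: h_def)
  from tendsto_mult[OF this assms(2)]
  have "((\<lambda>x. h (f x) * (f x / g x)) \<longlongrightarrow> l) F" by simp
  moreover have "h y * (y / z) = (1 - exp (- y)) / z" for y z by (simp add: h_def)
  ultimately show ?thesis by (simp only:)
qed

text \<open>Near the origin \<open>1 - cos t\<close> is \<open>t\<^sup>2/2\<close> and the denominator is \<open>(1 - \<kappa>)\<^sup>2\<close>; the powers of
  \<open>2\<close> and of \<open>1 - \<kappa>\<close> in the limit come from raising these to the power \<open>\<gamma>\<close>.\<close>

lemma sds_cf_at_0:
  assumes \<gamma>: "0 < \<gamma>" and \<kappa>: "0 \<le> \<kappa>" "\<kappa> < 1"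
  shows "((\<lambda>t. (1 - sds_cf \<gamma> lam \<kappa> t) / \<bar>t\<bar> powr (2 * \<gamma>))
           \<longlongrightarrow> lam / 2 powr \<gamma> * ((1 + \<kappa>) powr \<gamma> / (1 - \<kappa>) powr (2 * \<gamma>))) (at 0)"
proof -
  define q where "q t = ((1 - cos t) * (1 + \<kappa>)) / (\<kappa>\<^sup>2 - 2 * \<kappa> * cos t + 1)" for t
  have den: "\<kappa>\<^sup>2 - 2 * \<kappa> * cos t + 1 \<ge> (1 - \<kappa>)\<^sup>2" for t
    using mult_left_mono[OF cos_le_one[of t], of \<kappa>] \<kappa> by (simp add: power2_eq_square algebra_simps)
  have q_nonneg: "0 \<le> q t" for t
    unfolding q_def using \<kappa> by (intro divide_nonneg_nonneg mult_nonneg_nonneg order.trans[OF _ den]) auto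
  have "((\<lambda>t. (1 - cos t) / t\<^sup>2) \<longlongrightarrow> 1 / 2) (at (0 :: real))"
    by real_asymp
  moreover have "((\<lambda>t. (1 + \<kappa>) / (\<kappa>\<^sup>2 - 2 * \<kappa> * cos t + 1)) \<longlongrightarrow> (1 + \<kappa>) / (\<kappa>\<^sup>2 - 2 * \<kappa> * cos 0 + 1)) (at 0)"
  proof (intro tendsto_intros)
    show "\<kappa>\<^sup>2 - 2 * \<kappa> * cos 0 + 1 \<noteq> 0" using den[of 0] \<kappa> by (smt (verit) zero_less_power)
  qed
  ultimately have "((\<lambda>t. (1 - cos t) / t\<^sup>2 * ((1 + \<kappa>) / (\<kappa>\<^sup>2 - 2 * \<kappa> * cos t + 1)))
      \<longlongrightarrow> 1 / 2 * ((1 + \<kappa>) / (\<kappa>\<^sup>2 - 2 * \<kappa> * cos 0 + 1))) (at 0)"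
    by (rule tendsto_mult)
  moreover have "1 / 2 * ((1 + \<kappa>) / (\<kappa>\<^sup>2 - 2 * \<kappa> * cos 0 + 1)) = (1 + \<kappa>) / (2 * (1 - \<kappa>)\<^sup>2)"
    by (simp add: power2_eq_square algebra_simps)
  moreover have "(\<lambda>t. (1 - cos t) / t\<^sup>2 * ((1 + \<kappa>) / (\<kappa>\<^sup>2 - 2 * \<kappa> * cos t + 1))) = (\<lambda>t. q t / t\<^sup>2)"
    by (auto simp: q_def mult.commute)
  ultimately have q_lim: "((\<lambda>t. q t / t\<^sup>2) \<longlongrightarrow> (1 + \<kappa>) / (2 * (1 - \<kappa>)\<^sup>2)) (at 0)"
    by (simp only:)
  have pos: "0 < (1 + \<kappa>) / (2 * (1 - \<kappa>)\<^sup>2)" using \<kappa> by simp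
  have power_lim: "((\<lambda>t. lam * (q t / t\<^sup>2) powr \<gamma>) \<longlongrightarrow> lam * ((1 + \<kappa>) / (2 * (1 - \<kappa>)\<^sup>2)) powr \<gamma>) (at 0)"
    using pos by (intro tendsto_intros q_lim) auto
  have power_eq: "(q t / t\<^sup>2) powr \<gamma> = q t powr \<gamma> / \<bar>t\<bar> powr (2 * \<gamma>)" if "t \<noteq> 0" for t
  proof -
    have "\<bar>t\<bar> powr 2 = t\<^sup>2" using that by simp
    then have "(t\<^sup>2) powr \<gamma> = \<bar>t\<bar> powr (2 * \<gamma>)" by (metis powr_powr)
    then show ?thesis using q_nonneg[of t] by (simp add: powr_divide)
  qed
  have ratio: "((\<lambda>t. lam * q t powr \<gamma> / \<bar>t\<bar> powr (2 * \<gamma>)) \<longlongrightarrow> lam * ((1 + \<kappa>) / (2 * (1 - \<kappa>)\<^sup>2)) powr \<gamma>) (at 0)"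
    by (rule Lim_transform_eventually[OF power_lim]) (auto simp: eventually_at_filter power_eq)
  have "(q \<longlongrightarrow> (1 - cos 0) * (1 + \<kappa>) / (\<kappa>\<^sup>2 - 2 * \<kappa> * cos 0 + 1)) (at 0)"
    unfolding q_def
  proof (intro tendsto_intros)
    show "\<kappa>\<^sup>2 - 2 * \<kappa> * cos 0 + 1 \<noteq> 0" using den[of 0] \<kappa> by (smt (verit) zero_less_power)
  qed
  then have "(q \<longlongrightarrow> 0) (at 0)" by simp
  then have "((\<lambda>t. q t powr \<gamma>) \<longlongrightarrow> 0) (at 0)"
    using \<gamma> q_nonneg by (intro tendsto_zero_powrI[where b=\<gamma>]) auto
  then have "((\<lambda>t. lam * q t powr \<gamma>) \<longlongrightarrow> 0) (at 0)"
    by (rule tendsto_mult_right_zero)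
  from tendsto_one_minus_exp_uminus[OF this ratio]
  have "((\<lambda>t. (1 - sds_cf \<gamma> lam \<kappa> t) / \<bar>t\<bar> powr (2 * \<gamma>)) \<longlongrightarrow> lam * ((1 + \<kappa>) / (2 * (1 - \<kappa>)\<^sup>2)) powr \<gamma>) (at 0)"
    by (simp add: sds_cf_def q_def)
  moreover have "((1 - \<kappa>)\<^sup>2) powr \<gamma> = (1 - \<kappa>) powr (2 * \<gamma>)"
  proof -
    have "(1 - \<kappa>)\<^sup>2 = (1 - \<kappa>) powr 2" using \<kappa> by simp
    then show ?thesis by (simp only: powr_powr)
  qed
  ultimately show ?thesis using \<kappa> by (simp add: powr_divide powr_mult)
qed

text \<open>The reflection formula at \<open>2\<gamma>\<close> and the double angle formula. The value \<open>1/2\<close> is excluded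
  because there \<open>\<Gamma>(1 - 2\<gamma>)\<close> has its pole and the cosine its zero.\<close>

lemma Gamma_two_mult_sin:
  fixes \<gamma> :: real
  assumes "0 < \<gamma>" "\<gamma> < 1" "\<gamma> \<noteq> 1 / 2"
  shows "2 * Gamma (2 * \<gamma>) * sin (pi * \<gamma>) / pi = 1 / (Gamma (1 - 2 * \<gamma>) * cos (pi * \<gamma>))"
proof -
  have nint: "2 * \<gamma> \<notin> \<int>"
  proof
    assume "2 * \<gamma> \<in> \<int>"
    then obtain k where "2 * \<gamma> = of_int k" by (auto elim: Ints_cases)
    moreover from this have "0 < k" "k < 2" using assms by linarith+
    ultimately show False using assms(3) by (cases "k = 1") auto
  qed
  then have "1 - 2 * \<gamma> \<notin> \<int>\<^sub>\<le>\<^sub>0"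
    using Ints_diff[OF Ints_1, of "1 - 2 * \<gamma>"] nonpos_Ints_subset_Ints by auto
  then have G1: "Gamma (1 - 2 * \<gamma>) \<noteq> 0" by (simp add: Gamma_eq_zero_iff)
  have G2: "Gamma (2 * \<gamma>) \<noteq> 0" using assms by (intro less_imp_neq[THEN not_sym] Gamma_real_pos) simp
  have refl: "Gamma (2 * \<gamma>) * Gamma (1 - 2 * \<gamma>) = pi / (2 * sin (pi * \<gamma>) * cos (pi * \<gamma>))"
    using Gamma_reflection_real[OF nint] sin_double[of "pi * \<gamma>"] by (simp add: mult.left_commute)
  have "cos (pi * \<gamma>) \<noteq> 0" "sin (pi * \<gamma>) \<noteq> 0" using refl G1 G2 by auto
  with refl G1 show ?thesis by (simp add: field_simps)
qed

theorem theorem5p10: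
  fixes M :: "'a measure" and X :: "'a \<Rightarrow> int" and \<gamma> lam \<kappa> :: real
  assumes "0 < \<gamma>" and "\<gamma> < 1" and "0 < lam" and "0 \<le> \<kappa>" and "\<kappa> < 1"
    and "prob_space M"
    and "X \<in> measurable M (count_space UNIV)"
    and "is_SDS \<gamma> lam \<kappa> (distr M (count_space UNIV) X)"
  shows "((\<lambda>x::real. x powr (2 * \<gamma>) * measure M {\<omega> \<in> space M. real_of_int \<bar>X \<omega>\<bar> > x}) \<longlongrightarrow>
           (if \<gamma> \<noteq> 1 / 2
            then lam / 2 powr \<gamma> * ((1 + \<kappa>) powr \<gamma> / (1 - \<kappa>) powr (2 * \<gamma>))
                   * (1 / (Gamma (1 - 2 * \<gamma>) * cos (pi * \<gamma>)))
            else lam / 2 powr \<gamma> * ((1 + \<kappa>) powr \<gamma> / (1 - \<kappa>) powr (2 * \<gamma>)) * (2 / pi)))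
         at_top"
proof -
  note [measurable] = assms(7)
  define D where "D = distr M (count_space UNIV) X"
  define N where "N = distr M borel (\<lambda>\<omega>. real_of_int (X \<omega>))"
  define a where "a = lam / 2 powr \<gamma> * ((1 + \<kappa>) powr \<gamma> / (1 - \<kappa>) powr (2 * \<gamma>))"
  have a: "0 < a" using assms by (simp add: a_def)
  have ND: "N = distr D borel real_of_int"
    by (simp add: N_def D_def distr_distr comp_def)
  interpret M: prob_space M by fact
  interpret N: real_distribution N
    unfolding N_def by (intro M.real_distribution_distr) simp
  have D_sym: "distr D (count_space UNIV) uminus = D" and
    char_N: "\<And>t. char N t = complex_of_real (sds_cf \<gamma> lam \<kappa> t)"
    using assms(8) by (auto simp: is_SDS_def ND D_def)
  have sym: "distr N borel uminus = N"
  proof -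
    have "distr N borel uminus = distr (distr D (count_space UNIV) uminus) borel real_of_int"
      by (simp add: N_def D_def distr_distr comp_def)
    then show ?thesis by (simp add: D_sym ND)
  qed
  have "((\<lambda>t. (1 - Re (char N t)) / \<bar>t\<bar> powr (2 * \<gamma>)) \<longlongrightarrow> a) (at 0)"
    using sds_cf_at_0[OF assms(1,4,5)] by (simp add: char_N a_def)
  then have lim: "((\<lambda>x. x powr (2 * \<gamma>) * measure N {y. x < \<bar>y\<bar>})
      \<longlongrightarrow> 2 * a * Gamma (2 * \<gamma>) * sin (pi * (2 * \<gamma>) / 2) / pi) at_top"
    using assms(1,2) a by (intro N.tail_asymptotics_of_char sym) auto
  have tail: "measure N {y. x < \<bar>y\<bar>} = measure M {\<omega> \<in> space M. real_of_int \<bar>X \<omega>\<bar> > x}" for x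
    unfolding N_def by (subst measure_distr) (auto intro!: arg_cong[where f="measure M"])
  have const: "2 * a * Gamma (2 * \<gamma>) * sin (pi * (2 * \<gamma>) / 2) / pi =
      (if \<gamma> \<noteq> 1 / 2 then a * (1 / (Gamma (1 - 2 * \<gamma>) * cos (pi * \<gamma>))) else a * (2 / pi))"
  proof (cases "\<gamma> = 1 / 2")
    case False
    have "2 * a * Gamma (2 * \<gamma>) * sin (pi * (2 * \<gamma>) / 2) / pi = a * (2 * Gamma (2 * \<gamma>) * sin (pi * \<gamma>) / pi)"
      by simp
    then show ?thesis
      using False unfolding Gamma_two_mult_sin[OF assms(1,2) False] by simp
  next
    case True
    show ?thesis unfolding True by simp
  qed
  show ?thesis
    using lim unfolding tail const unfolding a_def .
qed

end
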